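(* Let $(X,T)$ be a dynamical system. If $(X,T)$ is almost Banach mean equicontinuous, then the topological entropy of $(X,T)$ is zero.
   Context: A dynamical system $(X,T)$ is a compact metric space $(X,d)$ together with a continuous map $T\colon X\to X$. $\omega(x,T)=\bigcap_{N\ge0}\overline{\{T^nx\colon n\ge N\}}$; $(X,T)$ is transitive if $\omega(x,T)=X$ for some $x\in X$. A point $x\in X$ is Banach mean equicontinuous if for every $\varepsilon>0$ there is $\delta>0$ such that for every $y\in X$ with $d(x,y)<\delta$, $\limsup_{M-N\to\infty}\frac1{M-N}\sum_{i=N}^{M-1}d(T^ix,T^iy)<\varepsilon$, where $0\le N<M$ are integers and $\limsup_{M-N\to\infty}$ means $\lim_{L\to\infty}\sup_{M-N\ge L}$. A system is almost Banach mean equicontinuous if it is transitive and has at least one Banach mean equicontinuous point. *)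

theory Defs
  imports "HOL-Analysis.Analysis"
begin

text \<open>
  The space is a compact subset \<open>X\<close> of an ambient metric type, with the induced metric; taking
  \<open>X = UNIV\<close> gives back a compact metric type. The map \<open>T\<close> matters only on \<open>X\<close>.
\<close>

definition dynamical_system :: "'a::metric_space set \<Rightarrow> ('a \<Rightarrow> 'a) \<Rightarrow> bool" where
  "dynamical_system X T \<longleftrightarrow> compact X \<and> continuous_on X T \<and> T ` X \<subseteq> X"

definition omega_limit :: "('a::metric_space \<Rightarrow> 'a) \<Rightarrow> 'a \<Rightarrow> 'a set" where
  "omega_limit T x = (\<Inter>N. closure {(T ^^ n) x | n. N \<le> n})"

definition transitive_system :: "'a::metric_space set \<Rightarrow> ('a \<Rightarrow> 'a) \<Rightarrow> bool" where
  "transitive_system X T \<longleftrightarrow> (\<exists>x\<in>X. omega_limit T x = X)"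

text \<open>
  The upper limit of a function of integers \<open>0 \<le> N < M\<close> as \<open>M - N\<close> tends to infinity. The suprema
  are taken in the extended reals, so they always exist and decrease in \<open>L\<close>; the limit
  therefore exists as well.
\<close>

definition window_limsup :: "(nat \<Rightarrow> nat \<Rightarrow> real) \<Rightarrow> ereal" where
  "window_limsup f = lim (\<lambda>L. SUP (N, M) \<in> {(N, M). N < M \<and> L \<le> M - N}. ereal (f N M))"

definition banach_mean_equicontinuous_point ::
    "'a::metric_space set \<Rightarrow> ('a \<Rightarrow> 'a) \<Rightarrow> 'a \<Rightarrow> bool" where
  "banach_mean_equicontinuous_point X T x \<longleftrightarrow> x \<in> X \<and>
    (\<forall>\<epsilon>>0. \<exists>\<delta>>0. \<forall>y\<in>X. dist x y < \<delta> \<longrightarrow>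
      window_limsup (\<lambda>N M. 1 / real (M - N) * (\<Sum>i=N..<M. dist ((T ^^ i) x) ((T ^^ i) y)))
        < ereal \<epsilon>)"

definition almost_banach_mean_equicontinuous ::
    "'a::metric_space set \<Rightarrow> ('a \<Rightarrow> 'a) \<Rightarrow> bool" where
  "almost_banach_mean_equicontinuous X T \<longleftrightarrow>
    transitive_system X T \<and> (\<exists>x. banach_mean_equicontinuous_point X T x)"

text \<open>
  Topological entropy in Bowen's form: the exponential growth rate of the least cardinality of
  an \<open>(n, \<epsilon>)\<close>-spanning set, followed by the limit \<open>\<epsilon> \<rightarrow> 0+\<close>. The condition
  \<open>\<forall>i<n. dist ((T ^^ i) x) ((T ^^ i) y) \<le> \<epsilon>\<close> says that the \<open>n\<close>-th Bowen distance of \<open>x\<close> and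
  \<open>y\<close> is at most \<open>\<epsilon>\<close>.
\<close>

definition spanning_set ::
    "'a::metric_space set \<Rightarrow> ('a \<Rightarrow> 'a) \<Rightarrow> nat \<Rightarrow> real \<Rightarrow> 'a set \<Rightarrow> bool" where
  "spanning_set X T n \<epsilon> E \<longleftrightarrow> finite E \<and> E \<subseteq> X \<and>
    (\<forall>y\<in>X. \<exists>x\<in>E. \<forall>i<n. dist ((T ^^ i) x) ((T ^^ i) y) \<le> \<epsilon>)"

definition spanning_number ::
    "'a::metric_space set \<Rightarrow> ('a \<Rightarrow> 'a) \<Rightarrow> nat \<Rightarrow> real \<Rightarrow> nat" where
  "spanning_number X T n \<epsilon> = (LEAST k. \<exists>E. spanning_set X T n \<epsilon> E \<and> card E = k)"

definition entropy_at_scale :: "'a::metric_space set \<Rightarrow> ('a \<Rightarrow> 'a) \<Rightarrow> real \<Rightarrow> ereal" where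
  "entropy_at_scale X T \<epsilon> = limsup (\<lambda>n. ereal (1 / real n * ln (real (spanning_number X T n \<epsilon>))))"

definition topological_entropy :: "'a::metric_space set \<Rightarrow> ('a \<Rightarrow> 'a) \<Rightarrow> ereal" where
  "topological_entropy X T = Lim (at_right 0) (entropy_at_scale X T)"

text \<open>
  For a nonempty system spanning sets exist and the entropy at scale \<open>\<epsilon>\<close> is monotone, so the
  operators \<open>LEAST\<close> and \<open>Lim\<close> above are meaningful.
\<close>

lemma spanning_set_exists:
  assumes "dynamical_system X T" "\<epsilon> > 0"
  shows "\<exists>E. spanning_set X T n \<epsilon> E"
proof -
  have X: "compact X" "continuous_on X T" "T ` X \<subseteq> X"
    using assms(1) by (auto simp: dynamical_system_def)
  have im: "(T ^^ i) ` X \<subseteq> X" for i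
    using X(3) by (induction i) auto
  have cont: "continuous_on X (T ^^ i)" for i
  proof (induction i)
    case (Suc i)
    have "continuous_on X (T \<circ> (T ^^ i))"
      by (rule continuous_on_compose[OF Suc continuous_on_subset[OF X(2) im]])
    then show ?case by simp
  qed (simp add: id_def)
  have "\<forall>x\<in>X. \<exists>d>0. \<forall>y\<in>X. dist y x < d \<longrightarrow> (\<forall>i<n. dist ((T ^^ i) x) ((T ^^ i) y) \<le> \<epsilon>)"
  proof
    fix x assume "x \<in> X"
    have "\<exists>d. d > 0 \<and> (\<forall>y\<in>X. dist y x < d \<longrightarrow> dist ((T ^^ i) x) ((T ^^ i) y) \<le> \<epsilon>)" for i
    proof -
      obtain d where "d > 0" "\<forall>y\<in>X. dist y x < d \<longrightarrow> dist ((T ^^ i) y) ((T ^^ i) x) < \<epsilon>"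
        using cont[of i] \<open>x \<in> X\<close> assms(2) unfolding continuous_on_iff by blast
      then show ?thesis
        by (intro exI[of _ d]) (auto simp: dist_commute intro: less_imp_le)
    qed
    then have "\<exists>d. \<forall>i. d i > 0 \<and>
        (\<forall>y\<in>X. dist y x < d i \<longrightarrow> dist ((T ^^ i) x) ((T ^^ i) y) \<le> \<epsilon>)"
      by (intro choice) blast
    then obtain d :: "nat \<Rightarrow> real" where d: "\<And>i. d i > 0"
      "\<And>i y. y \<in> X \<Longrightarrow> dist y x < d i \<Longrightarrow> dist ((T ^^ i) x) ((T ^^ i) y) \<le> \<epsilon>"
      by blast
    define e where "e = Min (insert 1 (d ` {..<n}))"
    have "e > 0" "\<And>i. i < n \<Longrightarrow> e \<le> d i"
      using d(1) by (auto simp: e_def)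
    then show "\<exists>d>0. \<forall>y\<in>X. dist y x < d \<longrightarrow> (\<forall>i<n. dist ((T ^^ i) x) ((T ^^ i) y) \<le> \<epsilon>)"
      using d(2) by (intro exI[of _ e]) force
  qed
  from bchoice[OF this] obtain d where d: "\<And>x. x \<in> X \<Longrightarrow> d x > 0"
    "\<And>x y. x \<in> X \<Longrightarrow> y \<in> X \<Longrightarrow> dist y x < d x \<Longrightarrow>
      (\<forall>i<n. dist ((T ^^ i) x) ((T ^^ i) y) \<le> \<epsilon>)"
    by blast
  have "X \<subseteq> (\<Union>x\<in>X. ball x (d x))"
    using d(1) by force
  then obtain E where E: "E \<subseteq> X" "finite E" "X \<subseteq> (\<Union>x\<in>E. ball x (d x))"
    by (rule compactE_image[OF X(1), of X "\<lambda>x. ball x (d x)", rotated]) auto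
  have "spanning_set X T n \<epsilon> E"
    unfolding spanning_set_def
  proof (intro conjI ballI)
    fix y assume "y \<in> X"
    then obtain x where x: "x \<in> E" "dist x y < d x"
      using E(3) by auto
    then show "\<exists>x\<in>E. \<forall>i<n. dist ((T ^^ i) x) ((T ^^ i) y) \<le> \<epsilon>"
      using d(2)[of x y] E(1) \<open>y \<in> X\<close> by (intro bexI[of _ x]) (auto simp: dist_commute)
  qed (use E in auto)
  then show ?thesis ..
qed

lemma spanning_number_attained:
  assumes "dynamical_system X T" "\<epsilon> > 0"
  shows "\<exists>E. spanning_set X T n \<epsilon> E \<and> card E = spanning_number X T n \<epsilon>"
proof -
  have "\<exists>k E. spanning_set X T n \<epsilon> E \<and> card E = k"
    using spanning_set_exists[OF assms, of n] by blast
  from LeastI_ex[OF this] show ?thesis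
    unfolding spanning_number_def .
qed

lemma spanning_number_pos:
  assumes "dynamical_system X T" "X \<noteq> {}" "\<epsilon> > 0"
  shows "spanning_number X T n \<epsilon> > 0"
proof -
  obtain E where E: "spanning_set X T n \<epsilon> E" "card E = spanning_number X T n \<epsilon>"
    using spanning_number_attained[OF assms(1,3)] by blast
  moreover have "E \<noteq> {}" "finite E"
    using E(1) assms(2) by (auto simp: spanning_set_def)
  ultimately show ?thesis
    by (metis card_gt_0_iff)
qed

lemma spanning_number_antimono:
  assumes "dynamical_system X T" "0 < \<epsilon>" "\<epsilon> \<le> \<epsilon>'"
  shows "spanning_number X T n \<epsilon>' \<le> spanning_number X T n \<epsilon>"
proof -
  obtain E where E: "spanning_set X T n \<epsilon> E" "card E = spanning_number X T n \<epsilon>"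
    using spanning_number_attained[OF assms(1,2)] by blast
  have "spanning_set X T n \<epsilon>' E"
    using E(1) assms(3) unfolding spanning_set_def by (meson order_trans)
  then have "\<exists>E'. spanning_set X T n \<epsilon>' E' \<and> card E' = card E"
    by blast
  then have "spanning_number X T n \<epsilon>' \<le> card E"
    unfolding spanning_number_def by (rule Least_le)
  then show ?thesis
    using E(2) by simp
qed

lemma entropy_at_scale_antimono:
  assumes "dynamical_system X T" "X \<noteq> {}" "0 < \<epsilon>" "\<epsilon> \<le> \<epsilon>'"
  shows "entropy_at_scale X T \<epsilon>' \<le> entropy_at_scale X T \<epsilon>"
  unfolding entropy_at_scale_def
proof (intro Limsup_mono always_eventually allI)
  fix n
  have "0 < spanning_number X T n \<epsilon>'"
    using assms by (intro spanning_number_pos) auto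
  with spanning_number_antimono[OF assms(1,3,4), of n]
  have "ln (real (spanning_number X T n \<epsilon>')) \<le> ln (real (spanning_number X T n \<epsilon>))"
    by simp
  then show "ereal (1 / real n * ln (real (spanning_number X T n \<epsilon>')))
      \<le> ereal (1 / real n * ln (real (spanning_number X T n \<epsilon>)))"
    by (simp add: divide_right_mono)
qed

lemma topological_entropy_eq_SUP:
  assumes "dynamical_system X T" "X \<noteq> {}"
  shows "(entropy_at_scale X T \<longlongrightarrow> (SUP \<epsilon>\<in>{0<..}. entropy_at_scale X T \<epsilon>)) (at_right 0)"
    and "topological_entropy X T = (SUP \<epsilon>\<in>{0<..}. entropy_at_scale X T \<epsilon>)"
proof -
  let ?S = "SUP \<epsilon>\<in>{0<..}. entropy_at_scale X T \<epsilon>"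
  show *: "(entropy_at_scale X T \<longlongrightarrow> ?S) (at_right 0)"
  proof (rule order_tendstoI)
    fix a assume "a < ?S"
    then obtain e where e: "e > 0" "a < entropy_at_scale X T e"
      by (auto simp: less_SUP_iff)
    have "\<forall>\<^sub>F x in at_right (0::real). 0 < x \<and> x < e"
      using e(1) by (auto simp: eventually_at_right_field)
    then show "\<forall>\<^sub>F x in at_right 0. a < entropy_at_scale X T x"
    proof eventually_elim
      case (elim x)
      then have "entropy_at_scale X T e \<le> entropy_at_scale X T x"
        by (intro entropy_at_scale_antimono[OF assms]) auto
      then show ?case using e(2) by simp
    qed
  next
    fix a assume "?S < a"
    have "\<forall>\<^sub>F x in at_right (0::real). 0 < x"
      by (simp add: eventually_at_right_less)
    then show "\<forall>\<^sub>F x in at_right 0. entropy_at_scale X T x < a"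
    proof eventually_elim
      case (elim x)
      then have "entropy_at_scale X T x \<le> ?S"
        by (intro SUP_upper) auto
      then show ?case using \<open>?S < a\<close> by simp
    qed
  qed
  show "topological_entropy X T = ?S"
    unfolding topological_entropy_def by (rule tendsto_Lim[OF _ *]) simp
qed

end

theory Submission
  imports Defs
begin

text \<open>
  By Baire's theorem, near a Banach mean equicontinuous point there is a nonempty open set \<open>V\<close> on
  which the mean distances are small over all windows of length at least one common \<open>L\<close>. A
  transitive point visits \<open>V\<close> at two times that differ by some \<open>k > 0\<close>, and density of its orbit
  shows that \<open>T^k\<close> is close to the identity in mean along every orbit segment of length at least
  \<open>L\<close>. So an orbit segment is described up to \<open>\<eta>\<close> by recording, at each time \<open>i\<close>, a new point of a
  finite net only if the point recorded for time \<open>i - k\<close> is no longer \<open>\<eta>\<close>-close. Each record after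
  the first \<open>k\<close> must be paid for by a drift of \<open>\<eta> / 2\<close> along a progression with difference \<open>k\<close>, so
  records are sparse, and the number of such descriptions grows at an arbitrarily small
  exponential rate.
\<close>

section \<open>Iterates, window limits and recurrence\<close>

lemma funpow_mem:
  assumes "dynamical_system X T" "x \<in> X"
  shows "(T ^^ i) x \<in> X"
  using assms by (induction i) (auto simp: dynamical_system_def)

lemma continuous_on_funpow:
  assumes "dynamical_system X T"
  shows "continuous_on X (T ^^ i)"
proof (induction i)
  case (Suc i)
  have "continuous_on ((T ^^ i) ` X) T"
    using assms funpow_mem[OF assms]
    by (auto simp: dynamical_system_def intro: continuous_on_subset)
  from continuous_on_compose[OF Suc this] show ?case by simp
qed (simp add: id_def)

text \<open>The suprema decrease in \<open>L\<close>, so their limit is their infimum, and a single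
  \<open>L\<close> already brings the supremum below \<open>\<epsilon>\<close>.\<close>

lemma window_limsup_lessD:
  assumes "window_limsup f < ereal \<epsilon>"
  obtains L where "\<And>N M. N < M \<Longrightarrow> L \<le> M - N \<Longrightarrow> f N M < \<epsilon>"
proof -
  let ?S = "\<lambda>L::nat. SUP (N, M) \<in> {(N, M). N < M \<and> L \<le> M - N}. ereal (f N M)"
  have "decseq ?S"
    by (intro decseq_SucI SUP_subset_mono) auto
  then have "lim ?S = (INF L. ?S L)"
    by (intro limI LIMSEQ_INF)
  then obtain L where "?S L < ereal \<epsilon>"
    using assms by (auto simp: window_limsup_def INF_less_iff)
  moreover have "ereal (f N M) \<le> ?S L" if "N < M" "L \<le> M - N" for N M
    using that by (intro SUP_upper2[of "(N, M)"]) auto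
  ultimately show ?thesis
    by (intro that[of L]) (meson ereal_less_le less_ereal.simps(1) order_le_less_trans)
qed

lemma omega_limit_frequently:
  assumes "x \<in> omega_limit T w" "e > 0"
  obtains n where "N \<le> n" "dist ((T ^^ n) w) x < e"
proof -
  have "x \<in> closure {(T ^^ n) w | n. N \<le> n}"
    using assms(1) by (auto simp: omega_limit_def)
  then show ?thesis
    using assms(2) that by (auto simp: closure_approachable)
qed

section \<open>Baire category and mean rigidity\<close>

text \<open>Equicontinuity at \<open>z\<close> gives a threshold \<open>L\<close> that depends on
  \<open>y\<close>. The points for which a given \<open>L\<close> works form a closed set
  \<open>K L\<close>, and these countably many sets cover a ball about \<open>z\<close>, so one has
  interior. That interior need not contain \<open>z\<close>.\<close>

lemma uniform_mean_close_on_open: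
  assumes sys: "dynamical_system X T"
    and z: "banach_mean_equicontinuous_point X T z" and "\<epsilon> > 0"
  obtains V L where "openin (top_of_set X) V" "V \<noteq> {}"
    "\<And>y N M. y \<in> V \<Longrightarrow> N < M \<Longrightarrow> L \<le> M - N \<Longrightarrow>
      (\<Sum>i=N..<M. dist ((T ^^ i) z) ((T ^^ i) y)) \<le> \<epsilon> * real (M - N)"
proof -
  define S where "S N M = {y\<in>X. (\<Sum>i=N..<M. dist ((T ^^ i) z) ((T ^^ i) y)) \<le> \<epsilon> * real (M - N)}"
    for N M
  define K where "K L = X \<inter> (\<Inter>(N, M) \<in> {(N, M). N < M \<and> L \<le> M - N}. S N M)" for L
  have "closedin (top_of_set X) (S N M)" for N M
  proof -
    have "continuous_on X (\<lambda>y. \<Sum>i=N..<M. dist ((T ^^ i) z) ((T ^^ i) y))"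
      by (intro continuous_intros continuous_on_funpow[OF sys, THEN continuous_on_compose2]) auto
    from continuous_closedin_preimage[OF this closed_atMost[of "\<epsilon> * real (M - N)"]]
    have "closedin (top_of_set X) (X \<inter> (\<lambda>y. \<Sum>i=N..<M. dist ((T ^^ i) z) ((T ^^ i) y)) -` {..\<epsilon> * real (M - N)})" .
    moreover have "X \<inter> (\<lambda>y. \<Sum>i=N..<M. dist ((T ^^ i) z) ((T ^^ i) y)) -` {..\<epsilon> * real (M - N)} = S N M"
      by (auto simp: S_def)
    ultimately show ?thesis by simp
  qed
  \<comment> \<open>The closedness of an intersection is available only for a nonempty
    family.\<close>
  moreover have "{(N, M). N < M \<and> L \<le> M - N} \<noteq> {}" for L :: nat
    by (rule ex_in_conv[THEN iffD1], rule exI[of _ "(0, Suc L)"]) simp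
  ultimately have closed: "closedin (top_of_set X) (K L)" for L
    unfolding K_def by (intro closedin_Int closedin_INT) auto
  obtain d where d: "d > 0" "\<And>y. y \<in> X \<Longrightarrow> dist z y < d \<Longrightarrow>
      window_limsup (\<lambda>N M. 1 / real (M - N) * (\<Sum>i=N..<M. dist ((T ^^ i) z) ((T ^^ i) y))) < ereal \<epsilon>"
    using z \<open>\<epsilon> > 0\<close> unfolding banach_mean_equicontinuous_point_def by blast
  have "z \<in> X"
    using z by (simp add: banach_mean_equicontinuous_point_def)
  have sub: "X \<inter> ball z d \<subseteq> \<Union>(range K)"
  proof
    fix y assume y: "y \<in> X \<inter> ball z d"
    then obtain L where L: "\<And>N M. N < M \<Longrightarrow> L \<le> M - N \<Longrightarrow>
        1 / real (M - N) * (\<Sum>i=N..<M. dist ((T ^^ i) z) ((T ^^ i) y)) < \<epsilon>"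
      using window_limsup_lessD[OF d(2)[of y]] by auto
    have "y \<in> K L"
      using y L by (force simp: K_def S_def field_simps)
    then show "y \<in> \<Union>(range K)" by blast
  qed
  have "\<exists>L. (top_of_set X) interior_of (K L) \<noteq> {}"
  proof (rule ccontr)
    assume "\<not> ?thesis"
    then have "(top_of_set X) interior_of \<Union>(range K) = {}"
      using sys closed
      by (intro Baire_category_alt)
        (auto simp: dynamical_system_def compact_space_subtopology compact_imp_locally_compact_space
          intro!: compact_Hausdorff_imp_regular_space Hausdorff_space_subtopology)
    moreover have "X \<inter> ball z d \<subseteq> (top_of_set X) interior_of \<Union>(range K)"
      by (intro interior_of_maximal sub openin_open_Int) simp
    ultimately show False
      using \<open>z \<in> X\<close> d(1) by auto
  qed
  then obtain L where L: "(top_of_set X) interior_of (K L) \<noteq> {}" ..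
  show ?thesis
  proof (rule that[of "(top_of_set X) interior_of (K L)" L])
    fix y N M assume "y \<in> (top_of_set X) interior_of (K L)" "N < M" "L \<le> M - N"
    moreover from this have "y \<in> K L"
      by (auto dest: interior_of_subset[THEN subsetD])
    ultimately show "(\<Sum>i=N..<M. dist ((T ^^ i) z) ((T ^^ i) y)) \<le> \<epsilon> * real (M - N)"
      by (auto simp: K_def S_def)
  qed (use L in auto)
qed

text \<open>Two orbit points in \<open>V\<close> both shadow \<open>z\<close> in mean, hence shadow
  each other. This bounds the drift along a tail of the orbit of \<open>w\<close>; for fixed
  \<open>n\<close> the drift is continuous in the point, so density carries the bound to all of
  \<open>X\<close> with the same \<open>L\<close>.\<close>

lemma mean_rigid:
  assumes sys: "dynamical_system X T"
    and "almost_banach_mean_equicontinuous X T" and "\<epsilon> > 0"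
  obtains k L where "0 < k" "\<And>x n. x \<in> X \<Longrightarrow> L \<le> n \<Longrightarrow>
    (\<Sum>i<n. dist ((T ^^ i) x) ((T ^^ (i + k)) x)) \<le> \<epsilon> * real n"
proof -
  obtain w z where w: "w \<in> X" "omega_limit T w = X" and z: "banach_mean_equicontinuous_point X T z"
    using assms(2) by (auto simp: almost_banach_mean_equicontinuous_def transitive_system_def)
  obtain V L where V: "openin (top_of_set X) V" "V \<noteq> {}"
    and L: "\<And>y N M. y \<in> V \<Longrightarrow> N < M \<Longrightarrow> L \<le> M - N \<Longrightarrow>
      (\<Sum>i=N..<M. dist ((T ^^ i) z) ((T ^^ i) y)) \<le> \<epsilon> / 2 * real (M - N)"
    using uniform_mean_close_on_open[OF sys z, of "\<epsilon> / 2"] \<open>\<epsilon> > 0\<close> by auto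
  obtain v e where v: "v \<in> X" "e > 0" "ball v e \<inter> X \<subseteq> V"
    using V by (metis openin_contains_ball openin_imp_subset subset_empty subset_iff equals0I)
  have visit: "\<exists>n\<ge>N. (T ^^ n) w \<in> V" for N
  proof -
    obtain n where "N \<le> n" "dist ((T ^^ n) w) v < e"
      using omega_limit_frequently[of v T w e N] v w by auto
    then show ?thesis
      using v(3) funpow_mem[OF sys w(1)] by (intro exI[of _ n]) (auto simp: dist_commute)
  qed
  obtain m where m: "(T ^^ m) w \<in> V"
    using visit by blast
  \<comment> \<open>\<open>Suc m\<close> makes the second visit strictly later, so that
    \<open>k\<close> is positive.\<close>
  obtain m' where m': "Suc m \<le> m'" "(T ^^ m') w \<in> V"
    using visit by blast
  define k where "k = m' - m"
  have k: "0 < k" "m' = k + m"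
    using m'(1) by (auto simp: k_def)
  define D where "D n x = (\<Sum>i<n. dist ((T ^^ i) x) ((T ^^ (i + k)) x))" for n x
  \<comment> \<open>The bound is uniform in \<open>p\<close> because the windows controlled by
    \<open>L\<close> may start at any time, here at \<open>q = p - m\<close>.\<close>
  have orbit: "D n ((T ^^ p) w) \<le> \<epsilon> * real n" if "L \<le> n" "m \<le> p" for n p
  proof (cases "n = 0")
    case False
    define q where "q = p - m"
    have p: "p = q + m"
      using that by (simp add: q_def)
    have add: "(T ^^ i) ((T ^^ j) w) = (T ^^ (i + j)) w" for i j
      by (simp add: funpow_add)
    have "D n ((T ^^ p) w) = (\<Sum>i<n. dist ((T ^^ (i + q)) ((T ^^ m) w)) ((T ^^ (i + q)) ((T ^^ m') w)))"
      unfolding D_def add p k(2) by (simp add: ac_simps)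
    also have "\<dots> = (\<Sum>i=q..<q+n. dist ((T ^^ i) ((T ^^ m) w)) ((T ^^ i) ((T ^^ m') w)))"
      using sum.shift_bounds_nat_ivl[of "\<lambda>i. dist ((T ^^ i) ((T ^^ m) w)) ((T ^^ i) ((T ^^ m') w))" 0 q n]
      by (simp add: lessThan_atLeast0 add.commute)
    also have "\<dots> \<le> (\<Sum>i=q..<q+n. dist ((T ^^ i) z) ((T ^^ i) ((T ^^ m) w))
        + dist ((T ^^ i) z) ((T ^^ i) ((T ^^ m') w)))"
      by (intro sum_mono) (metis dist_commute dist_triangle)
    also have "\<dots> \<le> \<epsilon> / 2 * real n + \<epsilon> / 2 * real n"
      unfolding sum.distrib
      using L[OF m, of q "q + n"] L[OF m'(2), of q "q + n"] that False by (intro add_mono) auto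
    finally show ?thesis by simp
  qed (simp add: D_def)
  have cont: "continuous_on X (D n)" for n
    unfolding D_def by (intro continuous_intros continuous_on_funpow[OF sys])
  show ?thesis
  proof (rule that[of k L])
    fix x n assume x: "x \<in> X" "L \<le> n"
    \<comment> \<open>Points of the omega-limit set are approached at arbitrarily late times, so the
      approximating time can be taken past \<open>m\<close>.\<close>
    have "D n x \<le> \<epsilon> * real n + r" if r: "r > 0" for r
    proof -
      obtain d where d: "d > 0" "\<And>y. y \<in> X \<Longrightarrow> dist y x < d \<Longrightarrow> dist (D n y) (D n x) < r"
        using cont[of n] x(1) r unfolding continuous_on_iff by metis
      obtain p where "m \<le> p" "dist ((T ^^ p) w) x < d"
        using omega_limit_frequently[of x T w d m] x w d(1) by auto
      with d(2)[OF funpow_mem[OF sys w(1)], of p] orbit[OF x(2), of p] show ?thesis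
        by (auto simp: dist_real_def)
    qed
    then show "(\<Sum>i<n. dist ((T ^^ i) x) ((T ^^ (i + k)) x)) \<le> \<epsilon> * real n"
      unfolding D_def by (rule field_le_epsilon)
  qed (fact k(1))
qed

section \<open>Counting sparse codes\<close>

lemma card_sparse_option_functions:
  fixes F :: "'a set" and t r :: real and n :: nat
  assumes "finite F" "0 < t" "t \<le> 1"
  defines "P \<equiv> {..<n} \<rightarrow>\<^sub>E insert None (Some ` F)"
  shows "real (card {e \<in> P. real (card {i\<in>{..<n}. e i \<noteq> None}) \<le> r})
    \<le> (1 + t * real (card F)) ^ n / t powr r"
proof -
  \<comment> \<open>Weigh each \<open>e\<close> by \<open>t\<close> to the number of its values \<open>\<noteq> None\<close>; the total weight factorises.\<close>
  let ?w = "\<lambda>e. \<Prod>i<n. if e i = None then 1 else t"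
  let ?Q = "{e \<in> P. real (card {i\<in>{..<n}. e i \<noteq> None}) \<le> r}"
  have fin: "finite P"
    unfolding P_def using assms by (intro finite_PiE) auto
  have w: "?w e = t powr real (card {i\<in>{..<n}. e i \<noteq> None})" for e :: "nat \<Rightarrow> 'a option"
    using assms by (simp add: prod.If_cases powr_realpow Int_def)
  have "real (card ?Q) * t powr r = (\<Sum>e\<in>?Q. t powr r)"
    by simp
  also have "\<dots> \<le> (\<Sum>e\<in>?Q. ?w e)"
    unfolding w using assms by (intro sum_mono powr_mono') auto
  also have "\<dots> \<le> (\<Sum>e\<in>P. ?w e)"
    using fin assms by (intro sum_mono2 prod_nonneg) auto
  also have "\<dots> = (\<Prod>i<n. \<Sum>a\<in>insert None (Some ` F). if a = None then 1 else t)"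
    unfolding P_def using assms by (subst prod_sum_PiE) auto
  also have "\<dots> = (1 + t * real (card F)) ^ n"
    using assms by (simp add: sum.reindex image_iff mult.commute)
  finally show ?thesis
    using assms by (simp add: field_simps)
qed

section \<open>Greedy coding of orbit segments\<close>

text \<open>Here \<open>p\<close> rounds to a finite net and \<open>u\<close> is an orbit. The code
  runs separately in each residue class modulo \<open>k\<close>; the guard \<open>k = 0\<close>
  secures termination.\<close>

fun greedy_code :: "('a::metric_space \<Rightarrow> 'a) \<Rightarrow> real \<Rightarrow> nat \<Rightarrow> (nat \<Rightarrow> 'a) \<Rightarrow> nat \<Rightarrow> 'a" where
  "greedy_code p \<eta> k u i =
    (if i < k \<or> k = 0 then p (u i)
     else if dist (greedy_code p \<eta> k u (i - k)) (u i) \<le> \<eta> then greedy_code p \<eta> k u (i - k)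
     else p (u i))"

declare greedy_code.simps [simp del]

definition greedy_updates ::
    "('a::metric_space \<Rightarrow> 'a) \<Rightarrow> real \<Rightarrow> nat \<Rightarrow> (nat \<Rightarrow> 'a) \<Rightarrow> nat \<Rightarrow> 'a option" where
  "greedy_updates p \<eta> k u i =
    (if i < k \<or> \<eta> < dist (greedy_code p \<eta> k u (i - k)) (u i) then Some (p (u i)) else None)"

lemma dist_greedy_code:
  assumes "0 \<le> \<eta>" "dist (p (u i)) (u i) \<le> \<eta>"
  shows "dist (greedy_code p \<eta> k u i) (u i) \<le> \<eta>"
  using assms by (subst greedy_code.simps) auto

text \<open>The updates determine the code recursively: \<open>None\<close> copies the value at
  \<open>i - k\<close>, and \<open>Some a\<close> sets it to \<open>a\<close>.\<close>

lemma greedy_code_eqI: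
  assumes "0 < k" "\<And>i. i < n \<Longrightarrow> greedy_updates p \<eta> k u i = greedy_updates p \<eta> k v i" "i < n"
  shows "greedy_code p \<eta> k u i = greedy_code p \<eta> k v i"
  using assms(3)
proof (induction i rule: less_induct)
  case (less i)
  show ?case
  proof (cases "i < k")
    case True
    then show ?thesis
      using assms(2)[OF less.prems]
      by (simp add: greedy_updates_def greedy_code.simps[where i=i])
  next
    case False
    then have "greedy_code p \<eta> k u (i - k) = greedy_code p \<eta> k v (i - k)"
      using less assms(1) by simp
    then show ?thesis
      using assms(1) assms(2)[OF less.prems] False
      by (auto simp: greedy_updates_def greedy_code.simps[where i=i] not_le split: if_splits)
  qed
qed

text \<open>The coding error is a potential: it grows by at most the drift over \<open>k\<close>
  steps, and each update costs \<open>\<eta> / 2\<close> of it. Of the \<open>3 * real k\<close>,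
  one \<open>k\<close> counts the forced initial updates and two come from the error at the first
  \<open>k\<close> times, at most \<open>\<eta>\<close> each.\<close>

lemma card_greedy_updates:
  assumes "0 < k" "0 < \<eta>" and p: "\<And>i. dist (p (u i)) (u i) \<le> \<eta> / 2"
  shows "real (card {i\<in>{..<n}. greedy_updates p \<eta> k u i \<noteq> None})
    \<le> 3 * real k + 2 / \<eta> * (\<Sum>i<n. dist (u i) (u (i + k)))"
proof -
  define \<phi> where "\<phi> i = dist (greedy_code p \<eta> k u i) (u i)" for i
  define h where "h i = (if greedy_updates p \<eta> k u i = None then 0 else 1 :: real)" for i
  have \<phi>: "0 \<le> \<phi> i" "\<phi> i \<le> \<eta>" for i
    using assms(2) p[of i] dist_greedy_code[of \<eta> p u i k] by (auto simp: \<phi>_def)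
  have h: "0 \<le> h i" "h i \<le> 1" for i
    by (auto simp: h_def)
  \<comment> \<open>An update drops the error \<open>\<phi>\<close> from above \<open>\<eta>\<close> to at most \<open>\<eta> / 2\<close>.\<close>
  have step: "\<eta> / 2 * h (i + k) + \<phi> (i + k) \<le> \<phi> i + dist (u i) (u (i + k))" for i
    using assms(1,2) p[of "i + k"]
      dist_triangle[of "greedy_code p \<eta> k u i" "u (i + k)" "u i"]
    by (auto simp: \<phi>_def h_def greedy_updates_def greedy_code.simps[where i="i + k"])
  have split: "(\<Sum>i<m + j. g i) = (\<Sum>i<m. g i) + (\<Sum>i<j. g (i + m))"
    for g :: "nat \<Rightarrow> real" and m j
    by (induction j) (auto simp: ac_simps)
  have shift: "(\<Sum>i<n. g i) + (\<Sum>i<k. g (i + n)) = (\<Sum>i<k. g i) + (\<Sum>i<n. g (i + k))"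
    for g :: "nat \<Rightarrow> real"
    using split[of g n k] split[of g k n] by (simp add: add.commute)
  have "\<eta> / 2 * (\<Sum>i<n. h (i + k)) + (\<Sum>i<n. \<phi> (i + k)) \<le> (\<Sum>i<n. \<phi> i) + (\<Sum>i<n. dist (u i) (u (i + k)))"
    using sum_mono[of "{..<n}", OF step] by (simp add: sum.distrib sum_distrib_left)
  \<comment> \<open>The two sums differ by \<open>k\<close> terms at either end; those at the far
    end are nonnegative and are dropped.\<close>
  moreover have "(\<Sum>i<n. \<phi> i) \<le> real k * \<eta> + (\<Sum>i<n. \<phi> (i + k))"
    using shift[of \<phi>] sum_bounded_above[of "{..<k}" \<phi> \<eta>] sum_nonneg[of "{..<k}" "\<lambda>i. \<phi> (i + n)"] \<phi> by simp
  ultimately have "(\<Sum>i<n. h (i + k)) \<le> 2 * real k + 2 / \<eta> * (\<Sum>i<n. dist (u i) (u (i + k)))"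
    using assms(2) by (simp add: field_simps)
  moreover have "(\<Sum>i<n. h i) \<le> real k + (\<Sum>i<n. h (i + k))"
    using shift[of h] sum_bounded_above[of "{..<k}" h 1] sum_nonneg[of "{..<k}" "\<lambda>i. h (i + n)"] h
    by simp
  moreover have "(\<Sum>i<n. h i) = real (card {i\<in>{..<n}. greedy_updates p \<eta> k u i \<noteq> None})"
    by (simp add: h_def sum.If_cases Int_def)
  ultimately show ?thesis by simp
qed

section \<open>From codes to spanning numbers and entropy\<close>

text \<open>One representative from each fibre of \<open>c\<close> gives a spanning set.\<close>

lemma spanning_number_le_of_code:
  assumes "finite (c ` X)"
    and "\<And>x y i. x \<in> X \<Longrightarrow> y \<in> X \<Longrightarrow> c x = c y \<Longrightarrow> i < n \<Longrightarrow> dist ((T ^^ i) x) ((T ^^ i) y) \<le> \<epsilon>"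
  shows "spanning_number X T n \<epsilon> \<le> card (c ` X)"
proof -
  obtain E where E: "E \<subseteq> X" "inj_on c E" "c ` X = c ` E"
    using subset_image_inj[of "c ` X" c X] by auto
  have "\<exists>x\<in>E. c x = c y" if "y \<in> X" for y
    using that E(3) by (metis imageE imageI)
  then have "spanning_set X T n \<epsilon> E"
    unfolding spanning_set_def using assms E
    by (metis finite_image_iff subset_iff)
  moreover have "card E = card (c ` X)"
    using E by (simp add: card_image)
  ultimately show ?thesis
    unfolding spanning_number_def by (intro Least_le) blast
qed

text \<open>Points with the same updates share a greedy code that is \<open>\<eta>\<close>-close to
  both orbits, whence the scale \<open>2 * \<eta>\<close>. Rigidity makes the updates sparse, so the
  counting bound applies.\<close>

lemma spanning_number_le_of_rigid:
  assumes "0 < k" "0 < \<eta>" "finite F" "0 < t" "t \<le> 1"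
    and F: "\<And>y. y \<in> X \<Longrightarrow> \<exists>a\<in>F. dist a y \<le> \<eta> / 2"
    and sys: "dynamical_system X T"
    and rigid: "\<And>x. x \<in> X \<Longrightarrow> (\<Sum>i<n. dist ((T ^^ i) x) ((T ^^ (i + k)) x)) \<le> s"
  shows "real (spanning_number X T n (2 * \<eta>))
    \<le> (1 + t * real (card F)) ^ n / t powr (3 * real k + 2 / \<eta> * s)"
proof -
  obtain p where p: "\<And>y. y \<in> X \<Longrightarrow> p y \<in> F \<and> dist (p y) y \<le> \<eta> / 2"
    using F by metis
  define u where "u x i = (T ^^ i) x" for x i
  have uX: "u x i \<in> X" if "x \<in> X" for x i
    using funpow_mem[OF sys that] by (simp add: u_def)
  \<comment> \<open>Restriction to times below \<open>n\<close> places the codes in a finite space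
    of extensional functions.\<close>
  define c where "c x = restrict (greedy_updates p \<eta> k (u x)) {..<n}" for x
  let ?Q = "{e \<in> {..<n} \<rightarrow>\<^sub>E insert None (Some ` F).
    real (card {i\<in>{..<n}. e i \<noteq> None}) \<le> 3 * real k + 2 / \<eta> * s}"
  have "c x \<in> ?Q" if x: "x \<in> X" for x
  proof -
    have eq: "{i\<in>{..<n}. c x i \<noteq> None} = {i\<in>{..<n}. greedy_updates p \<eta> k (u x) i \<noteq> None}"
      by (auto simp: c_def)
    have "real (card {i\<in>{..<n}. greedy_updates p \<eta> k (u x) i \<noteq> None})
        \<le> 3 * real k + 2 / \<eta> * (\<Sum>i<n. dist (u x i) (u x (i + k)))"
      using assms(1,2) p uX[OF x] by (intro card_greedy_updates) auto
    also have "2 / \<eta> * (\<Sum>i<n. dist (u x i) (u x (i + k))) \<le> 2 / \<eta> * s"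
      using rigid[OF x] assms(2) by (intro mult_left_mono) (auto simp: u_def)
    finally have "real (card {i\<in>{..<n}. c x i \<noteq> None}) \<le> 3 * real k + 2 / \<eta> * s"
      unfolding eq by simp
    moreover have "c x \<in> {..<n} \<rightarrow>\<^sub>E insert None (Some ` F)"
      using p uX[OF x] unfolding c_def by (intro restrict_PiE_iff[THEN iffD2]) (simp add: greedy_updates_def)
    ultimately show ?thesis by blast
  qed
  then have sub: "c ` X \<subseteq> ?Q" by (rule image_subsetI)
  have fin: "finite ?Q"
    using assms(3) by (intro finite_subset[OF _ finite_PiE[of "{..<n}" "\<lambda>_. insert None (Some ` F)"]]) auto
  have "spanning_number X T n (2 * \<eta>) \<le> card (c ` X)"
  proof (rule spanning_number_le_of_code)
    fix x y i assume xy: "x \<in> X" "y \<in> X" "c x = c y" "i < n"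
    have "greedy_updates p \<eta> k (u x) j = greedy_updates p \<eta> k (u y) j" if "j < n" for j
      using fun_cong[OF xy(3), of j] that by (simp add: c_def)
    then have eq: "greedy_code p \<eta> k (u x) i = greedy_code p \<eta> k (u y) i"
      using xy(4) assms(1) by (intro greedy_code_eqI) auto
    have "dist (greedy_code p \<eta> k (u v) i) (u v i) \<le> \<eta>" if "v \<in> X" for v
      using p[OF uX[OF that], of i] assms(2) by (intro dist_greedy_code) auto
    from this[OF xy(1)] this[OF xy(2)]
    show "dist ((T ^^ i) x) ((T ^^ i) y) \<le> 2 * \<eta>"
      using dist_triangle3[of "u x i" "u y i" "greedy_code p \<eta> k (u x) i"] eq
      by (simp add: u_def)
  qed (use sub fin finite_subset in blast)
  also have "\<dots> \<le> card ?Q"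
    using sub fin by (intro card_mono)
  finally show ?thesis
    using card_sparse_option_functions[OF assms(3-5), where r = "3 * real k + 2 / \<eta> * s" and n = n] by linarith
qed

text \<open>The rate \<open>\<kappa>\<close> is split into three thirds: the weights
  \<open>t\<close>, the updates caused by drift, and the \<open>3 * real k\<close> remaining
  updates. The choices must come in the order \<open>F\<close>, \<open>t\<close>,
  \<open>\<epsilon>\<close>, and then \<open>k\<close> and \<open>L\<close>, each depending on the
  earlier ones.\<close>

lemma entropy_at_scale_le:
  assumes sys: "dynamical_system X T" and abme: "almost_banach_mean_equicontinuous X T"
    and "X \<noteq> {}" "0 < \<eta>" "0 < \<kappa>"
  shows "entropy_at_scale X T (2 * \<eta>) \<le> ereal \<kappa>"
proof -
  have "compact X" using sys by (simp add: dynamical_system_def)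
  then obtain F where F: "finite F" "X \<subseteq> (\<Union>a\<in>F. ball a (\<eta> / 2))"
    by (rule compactE_image[where C = X and f = "\<lambda>a. ball a (\<eta> / 2)"]) (use \<open>0 < \<eta>\<close> in \<open>auto intro: centre_in_ball[THEN iffD2]\<close>)
  define t where "t = min 1 (\<kappa> / (3 * (real (card F) + 1)))"
  have t: "0 < t" "t \<le> 1" "t * real (card F) \<le> \<kappa> / 3"
  proof -
    show t: "0 < t" "t \<le> 1"
      using \<open>0 < \<kappa>\<close> by (auto simp: t_def)
    have "t * real (card F) \<le> t * (real (card F) + 1)"
      using t(1) by simp
    also have "\<dots> \<le> \<kappa> / (3 * (real (card F) + 1)) * (real (card F) + 1)"
      by (intro mult_right_mono) (auto simp: t_def)
    also have "\<dots> = \<kappa> / 3"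
      by (simp add: field_simps)
    finally show "t * real (card F) \<le> \<kappa> / 3" .
  qed
  define l where "l = - ln t"
  have l: "0 \<le> l" using t by (simp add: l_def)
  \<comment> \<open>Chosen so that drift updates, each costing \<open>l = - ln t\<close>, contribute
    at most \<open>\<kappa> / 3\<close> per unit time; \<open>l + 1\<close> covers
    \<open>l = 0\<close>, the case \<open>t = 1\<close>.\<close>
  define \<epsilon> where "\<epsilon> = \<kappa> * \<eta> / (6 * (l + 1))"
  have \<epsilon>: "0 < \<epsilon>" "2 / \<eta> * \<epsilon> * l \<le> \<kappa> / 3"
    using assms l by (auto simp: \<epsilon>_def field_simps)
  obtain k L where k: "0 < k" "\<And>x n. x \<in> X \<Longrightarrow> L \<le> n \<Longrightarrow>
    (\<Sum>i<n. dist ((T ^^ i) x) ((T ^^ (i + k)) x)) \<le> \<epsilon> * real n"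
    using mean_rigid[OF sys abme \<epsilon>(1)] by blast
  \<comment> \<open>The last condition on \<open>n\<close> lets the constant
    \<open>3 * real k * l\<close> be absorbed into the remaining third of
    \<open>\<kappa> * real n\<close>.\<close>
  have bound: "1 / real n * ln (real (spanning_number X T n (2 * \<eta>))) \<le> \<kappa>"
    if n: "L \<le> n" "0 < n" "9 * real k * l / \<kappa> \<le> real n" for n
  proof -
    let ?r = "3 * real k + 2 / \<eta> * (\<epsilon> * real n)"
    have pos: "0 < 1 + t * real (card F)"
      using t(1) by (intro add_pos_nonneg) auto
    have "real (spanning_number X T n (2 * \<eta>)) \<le> (1 + t * real (card F)) ^ n / t powr ?r"
      using F(2) k n(1) t assms
      by (intro spanning_number_le_of_rigid[OF _ _ F(1)]) (auto simp: less_imp_le subset_iff, meson less_imp_le)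
    then have "ln (real (spanning_number X T n (2 * \<eta>))) \<le> ln ((1 + t * real (card F)) ^ n / t powr ?r)"
      using spanning_number_pos[OF sys \<open>X \<noteq> {}\<close>, of "2 * \<eta>" n] assms by (intro ln_mono) auto
    also have "\<dots> = real n * ln (1 + t * real (card F)) + ?r * l"
      using pos t by (simp add: ln_div ln_powr ln_realpow l_def)
    also have "\<dots> \<le> real n * (\<kappa> / 3) + (3 * real k * l + real n * (\<kappa> / 3))"
    proof (intro add_mono mult_left_mono)
      show "ln (1 + t * real (card F)) \<le> \<kappa> / 3"
        using ln_add_one_self_le_self[of "t * real (card F)"] t by simp
      show "?r * l \<le> 3 * real k * l + real n * (\<kappa> / 3)"
        using mult_left_mono[OF \<epsilon>(2), of "real n"] by (simp add: algebra_simps)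
    qed simp
    also have "3 * real k * l \<le> real n * (\<kappa> / 3)"
      using n(3) assms by (simp add: field_simps)
    finally have "ln (real (spanning_number X T n (2 * \<eta>))) \<le> \<kappa> * real n" by simp
    then show ?thesis using n(2) by (simp add: field_simps)
  qed
  have "\<forall>\<^sub>F n in sequentially. 9 * real k * l / \<kappa> \<le> real n"
    using filterlim_real_sequentially by (simp add: filterlim_at_top)
  with eventually_ge_at_top[of L] eventually_gt_at_top[of 0]
  have "\<forall>\<^sub>F n in sequentially. ereal (1 / real n * ln (real (spanning_number X T n (2 * \<eta>)))) \<le> ereal \<kappa>"
    by eventually_elim (use bound in simp)
  then show ?thesis
    unfolding entropy_at_scale_def by (rule Limsup_bounded)
qed

theorem corollary6p7:
  fixes X :: "'a::metric_space set" and T :: "'a \<Rightarrow> 'a"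
  assumes "dynamical_system X T"
    and "almost_banach_mean_equicontinuous X T"
  shows "topological_entropy X T = 0"
proof -
  have "X \<noteq> {}"
    using assms(2) by (auto simp: almost_banach_mean_equicontinuous_def transitive_system_def)
  \<comment> \<open>Entropy is the supremum over all scales, so it suffices that the rate vanishes
    at each one.\<close>
  have "entropy_at_scale X T \<epsilon> = 0" if "0 < \<epsilon>" for \<epsilon>
  proof (rule antisym)
    show "entropy_at_scale X T \<epsilon> \<le> 0"
    proof (rule ereal_le_epsilon2)
      fix \<kappa> :: real assume "0 < \<kappa>"
      from entropy_at_scale_le[OF assms \<open>X \<noteq> {}\<close> _ this, of "\<epsilon> / 2"] that
      show "entropy_at_scale X T \<epsilon> \<le> 0 + ereal \<kappa>" by simp
    qed
    have "0 \<le> ln (real (spanning_number X T n \<epsilon>))" for n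
      using spanning_number_pos[OF assms(1) \<open>X \<noteq> {}\<close> that, of n] by simp
    then show "0 \<le> entropy_at_scale X T \<epsilon>"
      unfolding entropy_at_scale_def by (intro le_Limsup) auto
  qed
  then show ?thesis
    by (subst topological_entropy_eq_SUP(2)[OF assms(1) \<open>X \<noteq> {}\<close>]) simp
qed

end
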